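(* There exists a constant $c>0$ such that there exists a polynomial-time algorithm for the restriction of the Unfair Independent Set in Cycle problem to instances with $n\ge c\cdot k$.
   Context: Write $[n]=\{1,\ldots,n\}$. A subset of $[n]$ is stable if it contains no two consecutive elements and does not contain both $1$ and $n$ (i.e., it is independent in the cycle on $[n]$). Unfair Independent Set in Cycle problem: the input consists of positive integers $n$ and $k$ with $n\ge 2k$ and $\ell$ subsets $V_1,\ldots,V_\ell$ of $[n]$ (given explicitly), where $\ell\le n-2k+1$ and $|V_i|\ge 2$ for all $i\in[\ell]$. The goal is to find a stable $k$-subset $S$ of $[n]$ such that $|S\cap V_i|\le |V_i|/2$ for all $i\in[\ell]$. Algorithms are deterministic, and polynomial time means time polynomial in $n$. *)

theory Defs
  imports Complex_Main "HOL-Computational_Algebra.Polynomial"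
begin

section \<open>Random access machine\<close>

text \<open>
  The model of computation is the deterministic random access machine with addition and
  truncated subtraction, at unit cost per instruction, presented as structured programs. A program
  mentions finitely many registers by name; the unbounded memory is addressed indirectly, through
  register contents. There is deliberately no multiplication: an instruction lengthens the
  largest stored number by at most one bit (apart from the finitely many constants of the program),
  so unit-cost polynomial time on this machine is polynomial time on Turing machines.
\<close>

datatype instr =
    Const nat nat      \<comment> \<open>\<open>Const r m\<close>: r := m\<close>
  | Add nat nat nat    \<comment> \<open>\<open>Add r a b\<close>: r := a + b\<close>
  | Sub nat nat nat    \<comment> \<open>\<open>Sub r a b\<close>: r := max (a - b) 0\<close>
  | Load nat nat       \<comment> \<open>\<open>Load r a\<close>: r := mem[a]\<close>
  | Store nat nat      \<comment> \<open>\<open>Store a r\<close>: mem[a] := r\<close>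

datatype com =
    Skip
  | Basic instr
  | Seq com com
  | Cond nat com com   \<comment> \<open>branches on whether the register is nonzero\<close>
  | While nat com      \<comment> \<open>loops as long as the register is nonzero\<close>

record state =
  reg :: "nat \<Rightarrow> nat"
  mem :: "nat \<Rightarrow> nat"

fun step :: "instr \<Rightarrow> state \<Rightarrow> state" where
  "step (Const r m) s = s\<lparr>reg := (reg s)(r := m)\<rparr>"
| "step (Add r a b) s = s\<lparr>reg := (reg s)(r := reg s a + reg s b)\<rparr>"
| "step (Sub r a b) s = s\<lparr>reg := (reg s)(r := reg s a - reg s b)\<rparr>"
| "step (Load r a) s = s\<lparr>reg := (reg s)(r := mem s (reg s a))\<rparr>"
| "step (Store a r) s = s\<lparr>mem := (mem s)(reg s a := reg s r)\<rparr>"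

text \<open>\<open>exec c s t s'\<close>: started in \<open>s\<close>, the program \<open>c\<close> halts in \<open>s'\<close> after exactly \<open>t\<close> steps,
  where every instruction and every test of a register counts as one step.\<close>

inductive exec :: "com \<Rightarrow> state \<Rightarrow> nat \<Rightarrow> state \<Rightarrow> bool" where
  Skip: "exec Skip s 1 s"
| Basic: "exec (Basic i) s 1 (step i s)"
| Seq: "exec c s t s' \<Longrightarrow> exec d s' u s'' \<Longrightarrow> exec (Seq c d) s (t + u) s''"
| CondTrue: "reg s r \<noteq> 0 \<Longrightarrow> exec c s t s' \<Longrightarrow> exec (Cond r c d) s (Suc t) s'"
| CondFalse: "reg s r = 0 \<Longrightarrow> exec d s t s' \<Longrightarrow> exec (Cond r c d) s (Suc t) s'"
| WhileFalse: "reg s r = 0 \<Longrightarrow> exec (While r c) s 1 s"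
| WhileTrue: "reg s r \<noteq> 0 \<Longrightarrow> exec c s t s' \<Longrightarrow> exec (While r c) s' u s''
    \<Longrightarrow> exec (While r c) s (Suc (t + u)) s''"

inductive_cases exec_SkipE: "exec Skip s t s'"
inductive_cases exec_BasicE: "exec (Basic i) s t s'"
inductive_cases exec_SeqE: "exec (Seq c d) s t s'"
inductive_cases exec_CondE: "exec (Cond r c d) s t s'"
inductive_cases exec_WhileE: "exec (While r c) s t s'"

lemma exec_deterministic:
  assumes "exec c s t s'" and "exec c s u s''"
  shows "u = t \<and> s'' = s'"
  using assms
proof (induction arbitrary: u s'' rule: exec.induct)
  case (Skip s)
  then show ?case by (rule exec_SkipE) simp
next
  case (Basic i s)
  then show ?case by (rule exec_BasicE) simp
next
  case (Seq c s t s' d v s3)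
  from Seq.prems show ?case by (rule exec_SeqE) (use Seq.IH in blast)
next
  case (CondTrue s r c t s' d)
  from CondTrue.prems CondTrue.hyps(1) obtain v where "u = Suc v" "exec c s v s''"
    by - (erule exec_CondE; simp)
  with CondTrue.IH show ?case by blast
next
  case (CondFalse s r d t s' c)
  from CondFalse.prems CondFalse.hyps(1) obtain v where "u = Suc v" "exec d s v s''"
    by - (erule exec_CondE; simp)
  with CondFalse.IH show ?case by blast
next
  case (WhileFalse s r c)
  from WhileFalse.prems WhileFalse.hyps(1) show ?case
    by - (erule exec_WhileE; simp)
next
  case (WhileTrue s r c t s' v s3)
  from WhileTrue.prems WhileTrue.hyps(1) obtain t1 s1 u1
    where *: "u = Suc (t1 + u1)" "exec c s t1 s1" "exec (While r c) s1 u1 s''"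
    by - (erule exec_WhileE; simp)
  from WhileTrue.IH(1)[OF *(2)] * have "exec (While r c) s' u1 s''" "t1 = t" by simp_all
  with WhileTrue.IH(2) *(1) show ?case by blast
qed

definition initial_state :: "nat list \<Rightarrow> state" where
  "initial_state xs =
    \<lparr>reg = (\<lambda>_. 0), mem = (\<lambda>i. if i < length xs then xs ! i else 0)\<rparr>"

definition holds_output :: "state \<Rightarrow> nat list \<Rightarrow> bool" where
  "holds_output s ys \<longleftrightarrow> (\<forall>i < length ys. mem s i = ys ! i)"

text \<open>
  A search problem is given by its set \<open>I\<close> of admissible inputs, the relation \<open>sol x y\<close>
  (\<open>y\<close> is a correct answer for \<open>x\<close>), encodings of inputs and answers, and
  the size parameter in which the running time is measured. It is solvable in polynomial time if one
  program, on every admissible input, halts within polynomially many steps with the encoding of a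
  correct answer at the start of the memory. Nothing is required of inputs outside \<open>I\<close>.
\<close>

definition poly_time_solvable ::
  "'i set \<Rightarrow> ('i \<Rightarrow> 'o \<Rightarrow> bool) \<Rightarrow> ('i \<Rightarrow> nat list) \<Rightarrow> ('i \<Rightarrow> 'o \<Rightarrow> nat list) \<Rightarrow> ('i \<Rightarrow> nat) \<Rightarrow> bool"
where
  "poly_time_solvable I sol enc_in enc_out size_par \<longleftrightarrow>
    (\<exists>(P :: com) (p :: nat poly). \<forall>x \<in> I.
      \<exists>t s y. exec P (initial_state (enc_in x)) t s \<and> t \<le> poly p (size_par x) \<and>
        sol x y \<and> holds_output s (enc_out x y))"


section \<open>Unfair Independent Set in Cycle\<close>

definition stable :: "nat \<Rightarrow> nat set \<Rightarrow> bool" where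
  "stable n S \<longleftrightarrow>
    S \<subseteq> {1..n} \<and> (\<forall>i \<in> S. i + 1 \<notin> S) \<and> \<not> (1 \<in> S \<and> n \<in> S)"

record unfair_input =
  num_vertices :: nat            \<comment> \<open>\<open>n\<close>\<close>
  target_size :: nat             \<comment> \<open>\<open>k\<close>\<close>
  subsets :: "nat set list"      \<comment> \<open>\<open>V\<^sub>1, \<dots>, V\<^sub>\<ell>\<close>, repetitions allowed\<close>

definition unfair_inputs :: "unfair_input set" where
  "unfair_inputs = {x.
    num_vertices x \<ge> 1 \<and> target_size x \<ge> 1 \<and> num_vertices x \<ge> 2 * target_size x \<and>
    length (subsets x) \<le> num_vertices x - 2 * target_size x + 1 \<and>
    (\<forall>V \<in> set (subsets x). V \<subseteq> {1..num_vertices x} \<and> card V \<ge> 2)}"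

definition unfair_solution :: "unfair_input \<Rightarrow> nat set \<Rightarrow> bool" where
  "unfair_solution x S \<longleftrightarrow>
    stable (num_vertices x) S \<and> card S = target_size x \<and>
    (\<forall>V \<in> set (subsets x). real (card (S \<inter> V)) \<le> real (card V) / 2)"

text \<open>Subsets of \<open>{1..n}\<close> are given explicitly, as 0/1 vectors of length \<open>n\<close>.\<close>

definition char_vector :: "nat \<Rightarrow> nat set \<Rightarrow> nat list" where
  "char_vector n S = map (\<lambda>j. if j \<in> S then 1 else 0) [1..<Suc n]"

definition encode_input :: "unfair_input \<Rightarrow> nat list" where
  "encode_input x =
    [num_vertices x, target_size x, length (subsets x)] @
    concat (map (char_vector (num_vertices x)) (subsets x))"

definition encode_solution :: "unfair_input \<Rightarrow> nat set \<Rightarrow> nat list" where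
  "encode_solution x S = char_vector (num_vertices x) S"

end

theory Submission imports Defs begin

text \<open>
  Only even vertices are considered, which makes every selection stable. They are scanned in increasing
  order, and \<open>a\<close> joins \<open>S\<close> iff \<open>|S| < k\<close> and the weights of the sets containing \<open>a\<close> add up to
  less than \<open>16 ^ n\<close>. The weight of \<open>V\<close> is
  \<open>16 ^ (n + 1 - |V|) * 256 ^ |S \<inter> V| * 2 ^ |V \<inter> {a<..n}|\<close>, a pessimistic estimator, scaled
  to an integer, for the excess of \<open>|S \<inter> V|\<close> over \<open>|V| / 2\<close> when every later vertex is
  selected independently with probability at most \<open>1 / 256\<close>. A set that cannot take another element
  has weight at least \<open>16 ^ n\<close> and thereby blocks all of its vertices. Each step increases
  \<open>256 * 16 ^ n * |S|\<close> minus the total weight by at least \<open>16 ^ n\<close>, and the initial total weight is at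
  most \<open>n * 16 ^ n / 4\<close> because \<open>|V| \<ge> 2\<close>; for \<open>n \<ge> 1024 * k\<close> this leaves room for \<open>k\<close> vertices.
  All weights are powers of two, so the machine computes them by doubling.
\<close>

section \<open>The greedy algorithm\<close>

text \<open>A factor 16 outside \<open>V\<close> stands for a division by 16 inside
  \<open>V\<close>: the value stays an integer, and one pass over the vertices computes it without
  knowing \<open>card V\<close>.\<close>

definition weight :: "nat \<Rightarrow> nat set \<Rightarrow> nat set \<Rightarrow> nat \<Rightarrow> nat" where
  "weight n V S a =
    16 * (\<Prod>v = 1..n. if v \<in> V then if v \<in> S then 256 else if a < v then 2 else 1 else 16)"

definition load :: "nat \<Rightarrow> nat set list \<Rightarrow> nat set \<Rightarrow> nat \<Rightarrow> nat" where
  "load n Vs S a = (\<Sum>i<length Vs. if a \<in> Vs ! i then weight n (Vs ! i) S a else 0)"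

definition potential :: "nat \<Rightarrow> nat set list \<Rightarrow> nat set \<Rightarrow> nat \<Rightarrow> nat" where
  "potential n Vs S a = (\<Sum>i<length Vs. weight n (Vs ! i) S a)"

primrec greedy :: "nat \<Rightarrow> nat \<Rightarrow> nat set list \<Rightarrow> nat \<Rightarrow> nat set" where
  "greedy n k Vs 0 = {}"
| "greedy n k Vs (Suc i) =
    (let S = greedy n k Vs i; a = 2 * Suc i in
     if card S < k \<and> load n Vs S a < 16 ^ n then insert a S else S)"

lemma greedy_subset: "greedy n k Vs i \<subseteq> {a. even a \<and> 1 \<le> a \<and> a \<le> 2 * i}"
  by (induction i) (auto simp: Let_def)

lemma finite_greedy: "finite (greedy n k Vs i)"
  by (induction i) (auto simp: Let_def)

lemma card_greedy_le: "card (greedy n k Vs i) \<le> k"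
  by (induction i) (auto simp: Let_def card_insert_if finite_greedy)

lemma next_notin_greedy: "Suc (Suc (2 * i)) \<notin> greedy n k Vs i"
  using greedy_subset[of n k Vs i] by auto

section \<open>Estimates for weights and potential\<close>

lemma weight_antimono: "a \<le> b \<Longrightarrow> weight n V S b \<le> weight n V S a"
  unfolding weight_def by (intro mult_le_mono le_refl prod_mono) auto

lemma weight_split:
  assumes "a \<in> {1..n}" "a \<in> V"
  shows "weight n V S b =
    (if a \<in> S then 256 else if b < a then 2 else 1) *
    (16 * (\<Prod>v \<in> {1..n} - {a}. if v \<in> V then if v \<in> S then 256 else if b < v then 2 else 1 else 16))"
  unfolding weight_def using assms by (subst prod.remove[of _ a]) auto

text \<open>The factor of \<open>a\<close> is 2 while \<open>a\<close> is still to come and 1 once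
  it is rejected; no other factor grows. So a rejection at least halves every weight in which
  \<open>a\<close> occurs.\<close>

lemma weight_undecided:
  assumes "a \<in> {1..n}" "a \<in> V" "a \<notin> S" "b < a"
  shows "2 * weight n V S a \<le> weight n V S b"
  unfolding weight_split[OF assms(1,2)] using assms
  by (auto intro!: prod_mono)

lemma weight_insert:
  assumes "a \<in> {1..n}" "a \<notin> S"
  shows "weight n V (insert a S) a = (if a \<in> V then 256 else 1) * weight n V S a"
proof (cases "a \<in> V")
  case True
  have "(\<Prod>v \<in> {1..n} - {a}. if v \<in> V then if v \<in> insert a S then 256 else if a < v then 2 else 1 else 16)
      = (\<Prod>v \<in> {1..n} - {a}. if v \<in> V then if v \<in> S then 256 else if a < v then 2 else 1 else (16::nat))"
    by (intro prod.cong) auto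
  then show ?thesis
    unfolding weight_split[OF assms(1) True] using assms True by simp
next
  case False
  then show ?thesis
    unfolding weight_def by (auto intro!: prod.cong)
qed

text \<open>Dropping the factors 2 leaves \<open>256 = 16 ^ 2\<close> for each selected vertex of
  \<open>V\<close>. The exponent is at least \<open>n\<close> exactly when
  \<open>card V \<le> 2 * card (S \<inter> V) + 1\<close>, that is, when one more vertex would
  exceed half of \<open>V\<close>.\<close>

lemma weight_ge:
  assumes "V \<subseteq> {1..n}"
  shows "16 ^ (1 + 2 * card (S \<inter> V) + (n - card V)) \<le> weight n V S a"
proof -
  have fin: "finite V" using assms finite_subset by blast
  have "(\<Prod>v = 1..n. if v \<in> V then if v \<in> S then 256 else 1 else (16::nat)) =
      (\<Prod>v \<in> V. if v \<in> S then 256 else 1) * (\<Prod>v \<in> {1..n} - V. 16)"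
    using assms by (subst prod.subset_diff[of V]) (auto simp: mult.commute intro!: arg_cong2[where f="(*)"] prod.cong)
  also have "(\<Prod>v \<in> V. if v \<in> S then 256 else (1::nat)) = 256 ^ card (S \<inter> V)"
    using fin by (subst prod.If_cases) (auto simp: Int_commute)
  also have "(\<Prod>v \<in> {1..n} - V. (16::nat)) = 16 ^ (n - card V)"
    using assms fin by (simp add: card_Diff_subset)
  finally have eq: "(\<Prod>v = 1..n. if v \<in> V then if v \<in> S then 256 else 1 else (16::nat)) =
      256 ^ card (S \<inter> V) * 16 ^ (n - card V)" .
  have "(\<Prod>v = 1..n. if v \<in> V then if v \<in> S then 256 else 1 else (16::nat)) \<le>
      (\<Prod>v = 1..n. if v \<in> V then if v \<in> S then 256 else if a < v then 2 else 1 else 16)"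
    by (intro prod_mono) auto
  then show ?thesis
    unfolding eq weight_def by (simp add: power_add power_mult)
qed

text \<open>Each vertex of \<open>V\<close> contributes 2 instead of 16, so the weight is
  \<open>16 ^ (n + 1)\<close> divided by \<open>8 ^ card V\<close>; two vertices already bring it
  down to a quarter of \<open>16 ^ n\<close>.\<close>

lemma weight_empty_le:
  assumes "V \<subseteq> {1..n}" "2 \<le> card V"
  shows "4 * weight n V {} 0 \<le> 16 ^ n"
proof -
  have fin: "finite V" using assms finite_subset by blast
  have le: "card V \<le> n" using card_mono[OF _ assms(1)] by simp
  have "(\<Prod>v = 1..n. if v \<in> V then 2 else (16::nat)) =
      (\<Prod>v \<in> V. 2) * (\<Prod>v \<in> {1..n} - V. 16)"
    using assms by (subst prod.subset_diff[of V]) (auto simp: mult.commute intro!: arg_cong2[where f="(*)"] prod.cong)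
  also have "\<dots> = 2 ^ card V * 16 ^ (n - card V)"
    using assms fin by (simp add: card_Diff_subset)
  also have "(\<Prod>v = 1..n. if v \<in> V then 2 else (16::nat)) =
      (\<Prod>v = 1..n. if v \<in> V then if v \<in> {} then 256 else if 0 < v then 2 else 1 else 16)"
    by (intro prod.cong) auto
  finally have eq: "4 * weight n V {} 0 = 64 * (2 ^ card V * 16 ^ (n - card V))"
    unfolding weight_def by simp
  have "(64::nat) = 8 ^ 2" by simp
  also have "\<dots> \<le> 8 ^ card V" using assms(2) by (intro power_increasing) auto
  finally have "64 * 2 ^ card V \<le> 8 ^ card V * (2::nat) ^ card V" by simp
  also have "\<dots> = 16 ^ card V" by (simp flip: power_mult_distrib)
  finally have "64 * 2 ^ card V * 16 ^ (n - card V) \<le> 16 ^ card V * (16::nat) ^ (n - card V)"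
    by (rule mult_le_mono1)
  then show ?thesis unfolding eq using le by (simp flip: power_add)
qed

text \<open>Sets containing \<open>a\<close> lose at least their weight at \<open>a\<close>, by
  \<open>weight_undecided\<close>; the others do not gain.\<close>

lemma potential_step:
  assumes "a \<in> {1..n}" "a \<notin> S" "b < a"
  shows "potential n Vs S a + load n Vs S a \<le> potential n Vs S b"
  unfolding potential_def load_def sum.distrib[symmetric]
  using weight_undecided[OF assms(1) _ assms(2,3)] weight_antimono[of b a] assms(3)
  by (intro sum_mono) (auto simp: mult_2)

lemma potential_insert:
  assumes "a \<in> {1..n}" "a \<notin> S"
  shows "potential n Vs (insert a S) a = potential n Vs S a + 255 * load n Vs S a"
  unfolding potential_def load_def sum_distrib_left sum.distrib[symmetric]
  by (intro sum.cong) (auto simp: weight_insert[OF assms])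

text \<open>A vertex is skipped only if skipping it lowers the potential by at least \<open>16 ^ n\<close>, and an
  inserted vertex raises the potential by at most \<open>255 * 16 ^ n\<close>.\<close>

lemma greedy_progress:
  assumes "2 * i \<le> n" "card (greedy n k Vs i) < k"
  shows "16 ^ n * i + potential n Vs (greedy n k Vs i) (2 * i)
    \<le> 256 * 16 ^ n * card (greedy n k Vs i) + potential n Vs {} 0"
  using assms
proof (induction i)
  case 0
  then show ?case by simp
next
  case (Suc i)
  define S where "S = greedy n k Vs i"
  define a where "a = 2 * Suc i"
  define A where "A = load n Vs S a"
  have fin: "finite S" and aS: "a \<notin> S"
    using next_notin_greedy[of i n k Vs] finite_greedy by (auto simp: S_def a_def)
  have a: "a \<in> {1..n}" "2 * i < a" using Suc.prems by (auto simp: a_def)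
  have G: "greedy n k Vs (Suc i) = (if card S < k \<and> A < 16 ^ n then insert a S else S)"
    by (simp add: S_def a_def A_def Let_def)
  \<comment> \<open>The selection never shrinks, so it was below \<open>k\<close> before this round
    too: a vertex is rejected here only because of its load.\<close>
  then have lt: "card S < k" using Suc.prems fin aS by (auto split: if_splits)
  then have IH: "16 ^ n * i + potential n Vs S (2 * i) \<le> 256 * 16 ^ n * card S + potential n Vs {} 0"
    using Suc by (simp add: S_def)
  have st: "potential n Vs S a + A \<le> potential n Vs S (2 * i)"
    unfolding A_def by (rule potential_step[OF a(1) aS a(2)])
  show ?case
  proof (cases "A < 16 ^ n")
    case True
    \<comment> \<open>Moving on to \<open>a\<close> pays back \<open>A\<close> of the
      \<open>255 * A\<close> that the insertion costs. The net rise of at most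
      \<open>254 * A\<close>, plus \<open>16 ^ n\<close> for the round, fits into the credit
      \<open>256 * 16 ^ n\<close> for a new member.\<close>
    then have "potential n Vs (insert a S) a + 16 ^ n \<le> potential n Vs S (2 * i) + 256 * 16 ^ n"
      using st potential_insert[OF a(1) aS, of Vs] by (simp add: A_def)
    then show ?thesis
      using G lt True IH fin aS unfolding a_def[symmetric] by (simp add: algebra_simps)
  next
    case False
    then show ?thesis using G IH st unfolding a_def[symmetric] by (simp add: algebra_simps)
  qed
qed

text \<open>The load of an inserted vertex bounds the weight of each set containing it, and by
  \<open>weight_ge\<close> a weight below \<open>16 ^ n\<close> means that the set has room for one
  more vertex.\<close>

lemma greedy_half:
  assumes "2 * i \<le> n" "V \<in> set Vs" "V \<subseteq> {1..n}"
  shows "2 * card (greedy n k Vs i \<inter> V) \<le> card V"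
  using assms(1)
proof (induction i)
  case 0
  then show ?case by simp
next
  case (Suc i)
  define S where "S = greedy n k Vs i"
  define a where "a = 2 * Suc i"
  have IH: "2 * card (S \<inter> V) \<le> card V" using Suc by (simp add: S_def)
  show ?case
  proof (cases "card S < k \<and> load n Vs S a < 16 ^ n \<and> a \<in> V")
    case True
    obtain j where j: "j < length Vs" "Vs ! j = V" using assms(2) by (auto simp: in_set_conv_nth)
    have "weight n V S a \<le> load n Vs S a"
      unfolding load_def using True j
        member_le_sum[of j "{..<length Vs}" "\<lambda>i. if a \<in> Vs ! i then weight n (Vs ! i) S a else 0"]
      by auto
    then have "(16::nat) ^ (1 + 2 * card (S \<inter> V) + (n - card V)) < 16 ^ n"
      using True weight_ge[OF assms(3), of S a] by linarith
    then have "1 + 2 * card (S \<inter> V) + (n - card V) < n"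
      by (rule power_less_imp_less_exp[rotated]) simp
    moreover have "n = card V + (n - card V)" using card_mono[OF _ assms(3)] by simp
    ultimately have "1 + 2 * card (S \<inter> V) < card V" by linarith
    then have "2 * Suc (card (S \<inter> V)) \<le> card V" by simp
    moreover have "card (insert a S \<inter> V) \<le> Suc (card (S \<inter> V))"
      by (simp add: card_insert_if finite_greedy S_def Int_insert_left)
    moreover have "greedy n k Vs (Suc i) = insert a S"
      using True by (simp add: S_def a_def Let_def)
    ultimately show ?thesis by simp
  next
    case False
    then have "greedy n k Vs (Suc i) \<inter> V = S \<inter> V"
      by (auto simp: S_def a_def Let_def)
    then show ?thesis using IH by simp
  qed
qed

text \<open>With fewer than \<open>k\<close> vertices selected, four times
  \<open>greedy_progress\<close>, divided by \<open>16 ^ n\<close>, bounds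
  \<open>4 * (n div 2)\<close>, which is at least 2n - 2, by 1024 (k - 1) + n, which is at most 2n -
  1024. This is where 1024 = 4 * 256 comes from.\<close>

lemma card_greedy:
  assumes "1024 * k \<le> n" "length Vs \<le> n" "\<forall>V \<in> set Vs. V \<subseteq> {1..n} \<and> 2 \<le> card V"
  shows "card (greedy n k Vs (n div 2)) = k"
proof (rule ccontr)
  assume "card (greedy n k Vs (n div 2)) \<noteq> k"
  then have lt: "card (greedy n k Vs (n div 2)) < k"
    using card_greedy_le[of n k Vs "n div 2"] by linarith
  have "4 * potential n Vs {} 0 = (\<Sum>i<length Vs. 4 * weight n (Vs ! i) {} 0)"
    by (simp add: potential_def sum_distrib_left)
  also have "\<dots> \<le> (\<Sum>i<length Vs. 16 ^ n)"
    using assms(3) by (intro sum_mono weight_empty_le) auto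
  finally have init: "4 * potential n Vs {} 0 \<le> length Vs * 16 ^ n" by simp
  have "16 ^ n * (n div 2) \<le> 256 * 16 ^ n * card (greedy n k Vs (n div 2)) + potential n Vs {} 0"
    using greedy_progress[OF _ lt] by simp
  then have "16 ^ n * (4 * (n div 2)) \<le> 16 ^ n * (1024 * card (greedy n k Vs (n div 2)) + length Vs)"
    using init by (simp add: algebra_simps)
  then have "4 * (n div 2) \<le> 1024 * card (greedy n k Vs (n div 2)) + length Vs"
    by simp
  then show False using assms(1,2) lt by linarith
qed

lemma greedy_solution:
  assumes "x \<in> unfair_inputs" "1024 * target_size x \<le> num_vertices x"
  shows "unfair_solution x
    (greedy (num_vertices x) (target_size x) (subsets x) (num_vertices x div 2))"
proof -
  define n where "n = num_vertices x"
  define S where "S = greedy n (target_size x) (subsets x) (n div 2)"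
  have S: "S \<subseteq> {a. even a \<and> 1 \<le> a \<and> a \<le> 2 * (n div 2)}"
    unfolding S_def by (rule greedy_subset)
  have S': "even a \<and> 1 \<le> a \<and> a \<le> n" if "a \<in> S" for a
    using subsetD[OF S that] by auto
  have half: "2 * card (S \<inter> V) \<le> card V" if "V \<in> set (subsets x)" for V
    unfolding S_def using assms that by (intro greedy_half) (auto simp: unfair_inputs_def n_def)
  have "1 \<notin> S" using S'[of 1] by auto
  moreover have "a + 1 \<notin> S" if "a \<in> S" for a using S'[OF that] S'[of "a + 1"] by auto
  ultimately have "stable n S" unfolding stable_def using S by force
  moreover have "card S = target_size x"
    unfolding S_def using assms by (intro card_greedy) (auto simp: unfair_inputs_def n_def)
  moreover have "real (card (S \<inter> V)) \<le> real (card V) / 2" if "V \<in> set (subsets x)" for V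
    using of_nat_mono[OF half[OF that], where 'a = real] by simp
  ultimately show ?thesis by (simp add: unfair_solution_def n_def S_def)
qed

section \<open>Execution within a time bound\<close>

definition halts_in :: "nat \<Rightarrow> com \<Rightarrow> (state \<Rightarrow> bool) \<Rightarrow> state \<Rightarrow> bool" where
  "halts_in T c Q s \<longleftrightarrow> (\<exists>t s'. exec c s t s' \<and> t \<le> T \<and> Q s')"

text \<open>Blocks stay folded, so that straight-line code runs at once as
  \<open>fold step\<close>.\<close>

primrec block :: "instr list \<Rightarrow> com" where
  "block [] = Skip"
| "block (i # is) = Seq (Basic i) (block is)"

declare block.simps [simp del]

lemma halts_in_mono:
  "halts_in T c Q s \<Longrightarrow> T \<le> T' \<Longrightarrow> (\<And>s'. Q s' \<Longrightarrow> Q' s') \<Longrightarrow> halts_in T' c Q' s"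
  unfolding halts_in_def using order_trans by blast

lemma halts_in_Skip: "0 < T \<Longrightarrow> Q s \<Longrightarrow> halts_in T Skip Q s"
  unfolding halts_in_def using exec.Skip Suc_leI by (metis One_nat_def)

lemma halts_in_Seq:
  assumes "halts_in T c P s" "\<And>s'. P s' \<Longrightarrow> halts_in U d Q s'"
  shows "halts_in (T + U) (Seq c d) Q s"
proof -
  obtain t s' where c: "exec c s t s'" "t \<le> T" "P s'"
    using assms(1) by (auto simp: halts_in_def)
  obtain u s'' where d: "exec d s' u s''" "u \<le> U" "Q s''"
    using assms(2)[OF c(3)] by (auto simp: halts_in_def)
  show ?thesis
    unfolding halts_in_def using exec.Seq[OF c(1) d(1)] add_mono[OF c(2) d(2)] d(3) by blast
qed

lemma exec_block: "exec (block is) s (Suc (length is)) (fold step is s)"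
proof (induction "is" arbitrary: s)
  case Nil
  then show ?case using exec.Skip by (simp add: block.simps)
next
  case (Cons i "is")
  then show ?case using exec.Seq[OF exec.Basic[of i s] Cons[of "step i s"]] by (simp add: block.simps)
qed

lemma halts_in_block: "length is < T \<Longrightarrow> Q (fold step is s) \<Longrightarrow> halts_in T (block is) Q s"
  unfolding halts_in_def using exec_block[of "is" s] Suc_leI by blast

text \<open>The total budget is given and the cost subtracted, so backward chaining leaves only
  numerical side conditions. The extra step is the \<open>Skip\<close> closing a block.\<close>

lemma halts_in_block_Seq:
  assumes "length is < T" "halts_in (T - Suc (length is)) c Q (fold step is s)"
  shows "halts_in T (Seq (block is) c) Q s"
proof -
  have "halts_in (Suc (length is)) (block is) (\<lambda>s'. s' = fold step is s) s"
    by (rule halts_in_block) auto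
  from halts_in_Seq[OF this, of "T - Suc (length is)" c Q] assms show ?thesis by simp
qed

lemma halts_in_Seq_block:
  assumes "length is < T" "halts_in (T - Suc (length is)) c (\<lambda>s'. Q (fold step is s')) s"
  shows "halts_in T (Seq c (block is)) Q s"
  using halts_in_Seq[OF assms(2) halts_in_block[of "is" "Suc (length is)"]] assms(1) by simp

lemma halts_in_Cond:
  assumes "0 < T"
    and "reg s r \<noteq> 0 \<Longrightarrow> halts_in (T - 1) c Q s" "reg s r = 0 \<Longrightarrow> halts_in (T - 1) d Q s"
  shows "halts_in T (Cond r c d) Q s"
proof (cases "reg s r = 0")
  case True
  then obtain t s' where "exec d s t s'" "t \<le> T - 1" "Q s'"
    using assms(3) by (auto simp: halts_in_def)
  then show ?thesis unfolding halts_in_def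
    using exec.CondFalse[OF True, of d t s' c] assms(1) by (intro exI[of _ "Suc t"] exI[of _ s']) auto
next
  case False
  then obtain t s' where "exec c s t s'" "t \<le> T - 1" "Q s'"
    using assms(2) by (auto simp: halts_in_def)
  then show ?thesis unfolding halts_in_def
    using exec.CondTrue[OF False, of c t s' d] assms(1) by (intro exI[of _ "Suc t"] exI[of _ s']) auto
qed

text \<open>The invariant is indexed by the round. A round costs \<open>T\<close> plus one test; the
  strict inequality leaves room for the final failing test.\<close>

lemma halts_in_While:
  assumes "I 0 s"
    and "\<And>i s. i < N \<Longrightarrow> I i s \<Longrightarrow> reg s r \<noteq> 0 \<and> halts_in T c (I (Suc i)) s"
    and "\<And>s. I N s \<Longrightarrow> reg s r = 0 \<and> Q s"
    and "N * Suc T < U"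
  shows "halts_in U (While r c) Q s"
proof -
  have "halts_in ((N - i) * Suc T + 1) (While r c) Q s" if "i \<le> N" "I i s" for i s
    using that
  proof (induction i arbitrary: s rule: inc_induct)
    case base
    then show ?case using assms(3)[of s] exec.WhileFalse[of s r c] by (fastforce simp: halts_in_def)
  next
    case (step i)
    obtain t s' where c: "exec c s t s'" "t \<le> T" "I (Suc i) s'" "reg s r \<noteq> 0"
      using assms(2)[OF step.hyps(2) step.prems] by (auto simp: halts_in_def)
    obtain u s'' where w: "exec (While r c) s' u s''" "u \<le> (N - Suc i) * Suc T + 1" "Q s''"
      using step.IH[OF c(3)] by (auto simp: halts_in_def)
    have "(N - i) * Suc T = (N - Suc i) * Suc T + Suc T"
      using step.hyps(2) by (metis Suc_diff_Suc add.commute mult_Suc)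
    then have "Suc (t + u) \<le> (N - i) * Suc T + 1"
      using c(2) w(2) by simp
    then show ?case
      unfolding halts_in_def using exec.WhileTrue[OF c(4,1) w(1)] w(3) by blast
  qed
  from this[of 0 s] assms(1,4) show ?thesis by (auto elim: halts_in_mono)
qed

definition double :: "nat \<Rightarrow> nat \<Rightarrow> instr list" where
  "double m r = replicate m (Add r r r)"

lemma length_double [simp]: "length (double m r) = m"
  by (simp add: double_def)

lemma fold_double [simp]:
  "fold step (double m r) s = s\<lparr>reg := (reg s)(r := 2 ^ m * reg s r)\<rparr>"
  unfolding double_def by (induction m arbitrary: s) (simp_all add: algebra_simps mult_2)

text \<open>Frame condition for subroutines that write registers only.\<close>

definition unchanged :: "nat set \<Rightarrow> state \<Rightarrow> state \<Rightarrow> bool" where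
  "unchanged R s s' \<longleftrightarrow> (\<forall>r. r \<notin> R \<longrightarrow> reg s' r = reg s r) \<and> mem s' = mem s"

section \<open>The program\<close>

text \<open>\<open>rN\<close>, \<open>rL\<close>, \<open>rOne\<close> hold \<open>n\<close>, \<open>\<ell>\<close>, \<open>1\<close>; \<open>rK\<close> counts the vertices still to be selected, \<open>rBase\<close> and
  \<open>rRow\<close> are the addresses of \<open>S\<close> and of the current \<open>V\<^sub>i\<close>, \<open>rThr\<close> is the threshold \<open>16 ^ n\<close>, \<open>rA\<close> the
  candidate vertex, \<open>rTot\<close> its load and \<open>rW\<close> a single weight; \<open>rM\<close>, \<open>rI\<close>, \<open>rD\<close> control the
  loops, \<open>rV\<close> runs through the vertices, \<open>rX\<close> and \<open>rP\<close> are scratch.\<close>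

abbreviation (input) "rN \<equiv> 2 :: nat"
abbreviation (input) "rK \<equiv> 3 :: nat"
abbreviation (input) "rL \<equiv> 4 :: nat"
abbreviation (input) "rOne \<equiv> 5 :: nat"
abbreviation (input) "rBase \<equiv> 6 :: nat"
abbreviation (input) "rThr \<equiv> 7 :: nat"
abbreviation (input) "rA \<equiv> 8 :: nat"
abbreviation (input) "rM \<equiv> 9 :: nat"
abbreviation (input) "rRow \<equiv> 10 :: nat"
abbreviation (input) "rTot \<equiv> 11 :: nat"
abbreviation (input) "rI \<equiv> 12 :: nat"
abbreviation (input) "rV \<equiv> 13 :: nat"
abbreviation (input) "rD \<equiv> 14 :: nat"
abbreviation (input) "rX \<equiv> 15 :: nat"
abbreviation (input) "rP \<equiv> 16 :: nat"
abbreviation (input) "rW \<equiv> 17 :: nat"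

text \<open>Doubling 8, 1 or 4 times multiplies by 256, 2 or 16. The truncated difference of
  \<open>rV\<close> and \<open>rA\<close> is nonzero exactly for vertices after the
  candidate.\<close>

definition weight_body :: com where
  "weight_body =
    Seq (block [Add rV rV rOne, Add rP rRow rV, Load rX rP])
    (Seq (Cond rX
           (Seq (block [Add rP rBase rV, Load rX rP])
           (Cond rX
             (block (double 8 rW))
             (Seq (block [Sub rX rV rA]) (Cond rX (block (double 1 rW)) Skip))))
           (block (double 4 rW)))
    (block [Sub rD rN rV]))"

definition weight_prog :: com where
  "weight_prog =
    Seq (block [Const rW 16, Const rV 0, Sub rD rN rV]) (While rD weight_body)"

definition load_body :: com where
  "load_body =
    Seq (block [Add rP rRow rA, Load rX rP])
    (Seq (Cond rX (Seq weight_prog (block [Add rTot rTot rW])) Skip)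
    (block [Add rRow rRow rN, Sub rI rI rOne]))"

text \<open>The first row starts in cell 3, behind the three header cells, hence the address 2.
  Adding the zero in \<open>rTot\<close> copies \<open>rL\<close>.\<close>

definition load_prog :: com where
  "load_prog = Seq (block [Const rTot 0, Const rRow 2, Add rI rL rTot]) (While rI load_body)"

definition pick_prog :: com where
  "pick_prog =
    Cond rK
      (Seq load_prog
      (Seq (block [Sub rX rThr rTot])
      (Cond rX (block [Add rP rBase rA, Store rP rOne, Sub rK rK rOne]) Skip)))
      Skip"

definition greedy_body :: com where
  "greedy_body =
    Seq (block [Add rA rA rOne, Add rA rA rOne])
    (Seq pick_prog
    (block [Sub rM rN rOne, Sub rM rM rA]))"

text \<open>\<open>rM\<close> is kept at n - 1 - a, truncated: nonzero exactly when vertex a + 2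
  still exists.\<close>

definition greedy_prog :: com where
  "greedy_prog = Seq (block [Const rA 0, Sub rM rN rOne]) (While rM greedy_body)"

text \<open>Loops stand in for the missing multiplication: the first adds \<open>n\<close> once per
  subset to get the address of \<open>S\<close>, the second computes \<open>16 ^ n\<close> by four
  doublings per round.\<close>

definition init_prog :: com where
  "init_prog =
    Seq (block [Const rP 0, Load rN rP, Const rOne 1, Load rK rOne, Const rP 2, Load rL rP,
                Const rBase 2, Const rI 0, Add rI rL rI])
    (Seq (While rI (block [Add rBase rBase rN, Sub rI rI rOne]))
    (Seq (block [Const rThr 1, Const rI 0, Add rI rN rI])
    (While rI (Seq (block (double 4 rThr)) (block [Sub rI rI rOne])))))"

definition copy_prog :: com where
  "copy_prog =
    Seq (block [Const rV 0, Sub rD rN rV])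
    (While rD
      (block [Add rP rBase rV, Add rP rP rOne, Load rX rP, Store rV rX,
              Add rV rV rOne, Sub rD rN rV]))"

definition unfair_prog :: com where
  "unfair_prog = Seq init_prog (Seq greedy_prog copy_prog)"

text \<open>Rows are addressed one cell before their start, so that vertices keep their numbers
  \<open>1, \<dots>, n\<close>. The vector of \<open>S\<close> is kept directly behind the input.\<close>

definition stores :: "nat \<Rightarrow> nat \<Rightarrow> nat set \<Rightarrow> state \<Rightarrow> bool" where
  "stores n p V s \<longleftrightarrow> (\<forall>v \<in> {1..n}. mem s (p + v) = (if v \<in> V then 1 else 0))"

lemma storesD: "stores n p V s \<Longrightarrow> 1 \<le> v \<Longrightarrow> v \<le> n \<Longrightarrow> mem s (p + v) = (if v \<in> V then 1 else 0)"
  by (simp add: stores_def)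

section \<open>Correctness and running time of the subroutines\<close>

lemma weight_prog:
  assumes "reg s rN = n" "reg s rOne = 1" "reg s rA = a"
    and "stores n (reg s rRow) V s" "stores n (reg s rBase) S s"
  shows "halts_in (30 * n + 10) weight_prog
    (\<lambda>s'. reg s' rW = weight n V S a \<and> unchanged {rW, rV, rD, rX, rP} s s') s"
proof -
  define f where "f v = (if v \<in> V then if v \<in> S then 256 else if a < v then 2 else 1 else (16::nat))" for v
  define I where "I i s' \<longleftrightarrow> reg s' rW = 16 * (\<Prod>v = 1..i. f v) \<and> reg s' rV = i \<and>
    reg s' rD = n - i \<and> unchanged {rW, rV, rD, rX, rP} s s'" for i s'
  have "reg s' rD \<noteq> 0 \<and> halts_in 25 weight_body (I (Suc i)) s'" if i: "i < n" and I: "I i s'" for i s'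
  proof
    show "reg s' rD \<noteq> 0" using i I by (simp add: I_def)
  next
    have "mem s' (reg s rRow + Suc i) = (if Suc i \<in> V then 1 else 0)"
      "mem s' (reg s rBase + Suc i) = (if Suc i \<in> S then 1 else 0)"
      using storesD[OF assms(4), of "Suc i"] storesD[OF assms(5), of "Suc i"] i I
      by (auto simp: I_def unchanged_def)
    then show "halts_in 25 weight_body (I (Suc i)) s'"
      unfolding weight_body_def using I assms(1-3)
      by (intro halts_in_block_Seq halts_in_Seq_block halts_in_Cond halts_in_block halts_in_Skip)
         (auto simp: I_def unchanged_def f_def split: if_splits)
  qed
  then show ?thesis
    unfolding weight_prog_def using assms
    by (intro halts_in_block_Seq halts_in_While[where I = I and N = n and T = 25])
       (auto simp: I_def unchanged_def weight_def f_def)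
qed

text \<open>The part of the invariant common to all rounds; \<open>rK\<close> and \<open>rA\<close>
  vary with the round and are tracked separately.\<close>

definition represents :: "nat \<Rightarrow> nat set list \<Rightarrow> nat set \<Rightarrow> state \<Rightarrow> bool" where
  "represents n Vs S s \<longleftrightarrow>
    reg s rN = n \<and> reg s rL = length Vs \<and> reg s rOne = 1 \<and> reg s rThr = 16 ^ n \<and>
    reg s rBase = 2 + length Vs * n \<and> stores n (2 + length Vs * n) S s \<and>
    (\<forall>i < length Vs. stores n (2 + i * n) (Vs ! i) s)"

lemma represents_unchanged:
  assumes "represents n Vs S s" "unchanged R s s'" "R \<inter> {rN, rL, rOne, rThr, rBase} = {}"
  shows "represents n Vs S s'"
proof -
  have "rN \<notin> R" "rL \<notin> R" "rOne \<notin> R" "rThr \<notin> R" "rBase \<notin> R" using assms(3) by blast+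
  then show ?thesis using assms(1,2) by (simp add: represents_def unchanged_def stores_def)
qed

lemma load_prog:
  assumes s: "represents n Vs S s" "reg s rA = a" "a \<in> {1..n}"
  shows "halts_in (length Vs * (30 * n + 20) + 10) load_prog
    (\<lambda>s'. reg s' rTot = load n Vs S a \<and>
       unchanged {rTot, rRow, rI, rW, rV, rD, rX, rP} s s') s"
proof -
  let ?R = "{rTot, rRow, rI, rW, rV, rD, rX, rP}"
  define I where "I i s' \<longleftrightarrow>
    reg s' rTot = (\<Sum>j<i. if a \<in> Vs ! j then weight n (Vs ! j) S a else 0) \<and>
    reg s' rRow = 2 + i * n \<and> reg s' rI = length Vs - i \<and> unchanged ?R s s'" for i s'
  have "reg s' rI \<noteq> 0 \<and> halts_in (30 * n + 19) load_body (I (Suc i)) s'"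
    if i: "i < length Vs" and I: "I i s'" for i s'
  proof
    show "reg s' rI \<noteq> 0" using i I by (simp add: I_def)
  next
    define s1 where "s1 = fold step [Add rP rRow rA, Load rX rP] s'"
    have u: "unchanged ?R s s1" using I by (simp add: s1_def I_def unchanged_def)
    have r: "represents n Vs S s1" by (rule represents_unchanged[OF s(1) u]) auto
    have s1: "reg s1 rA = a" "reg s1 rRow = 2 + i * n" "reg s1 rI = length Vs - i"
      "reg s1 rTot = (\<Sum>j<i. if a \<in> Vs ! j then weight n (Vs ! j) S a else 0)"
      using I s(2) by (simp_all add: s1_def I_def unchanged_def)
    have "stores n (2 + i * n) (Vs ! i) s"
      using s(1) i by (simp add: represents_def)
    then have "mem s (2 + i * n + a) = (if a \<in> Vs ! i then 1 else 0)"
      using s(3) by (intro storesD) auto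
    then have x: "reg s1 rX = (if a \<in> Vs ! i then 1 else 0)"
      using I s(2) by (simp add: s1_def I_def unchanged_def)
    have w: "halts_in (30 * n + 10) weight_prog
      (\<lambda>s'. reg s' rW = weight n (Vs ! i) S a \<and> unchanged {rW, rV, rD, rX, rP} s1 s') s1"
      using r s1 i by (intro weight_prog) (simp_all add: represents_def)
    \<comment> \<open>The invariant pulled back through the closing block, a common goal for both
      branches.\<close>
    let ?Q = "\<lambda>s'. I (Suc i) (fold step [Add rRow rRow rN, Sub rI rI rOne] s')"
    have visit: "halts_in (30 * n + 13 - 1) (Seq weight_prog (block [Add rTot rTot rW])) ?Q s1"
      if "reg s1 rX \<noteq> 0"
    proof -
      have "a \<in> Vs ! i" using that x by (simp split: if_splits)
      then show ?thesis
        using u s1 r i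
        by (intro halts_in_Seq_block halts_in_mono[OF w])
           (auto simp: I_def unchanged_def represents_def)
    qed
    have skip: "halts_in (30 * n + 13 - 1) Skip ?Q s1" if "reg s1 rX = 0"
    proof -
      have "a \<notin> Vs ! i" using that x by (simp split: if_splits)
      then show ?thesis
        using u s1 r i
        by (intro halts_in_Skip) (auto simp: I_def unchanged_def represents_def)
    qed
    have branch: "halts_in (30 * n + 13)
      (Cond rX (Seq weight_prog (block [Add rTot rTot rW])) Skip) ?Q s1"
      by (intro halts_in_Cond visit skip) simp_all
    have rest: "halts_in (30 * n + 16)
      (Seq (Cond rX (Seq weight_prog (block [Add rTot rTot rW])) Skip)
        (block [Add rRow rRow rN, Sub rI rI rOne])) (I (Suc i)) s1"
      by (rule halts_in_Seq_block[OF _ halts_in_mono[OF branch]]) simp_all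
    show "halts_in (30 * n + 19) load_body (I (Suc i)) s'"
      unfolding load_body_def
      by (rule halts_in_block_Seq[OF _ halts_in_mono[OF rest[unfolded s1_def]]]) simp_all
  qed
  then show ?thesis
    unfolding load_prog_def using s
    by (intro halts_in_block_Seq halts_in_While[where I = I and N = "length Vs" and T = "30 * n + 19"])
       (auto simp: I_def unchanged_def load_def represents_def algebra_simps)
qed

lemma stores_update:
  assumes "stores n p S s" "a \<in> {1..n}" "mem s' = (mem s)(p + a := 1)"
  shows "stores n p (insert a S) s'"
  using assms by (auto simp: stores_def)

lemma stores_update_other:
  assumes "stores n p V s" "p + n < q" "mem s' = (mem s)(q := x)"
  shows "stores n p V s'"
  using assms by (auto simp: stores_def)

lemma pick_prog:
  assumes s: "represents n Vs S s" "reg s rA = a" "a \<in> {1..n}" "reg s rK = k - card S"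
    and S: "finite S" "a \<notin> S"
  shows "halts_in (length Vs * (30 * n + 20) + 20) pick_prog
    (\<lambda>s'. reg s' rA = a \<and>
      (let S' = if card S < k \<and> load n Vs S a < 16 ^ n then insert a S else S
       in represents n Vs S' s' \<and> reg s' rK = k - card S')) s"
    (is "halts_in _ _ ?Q s")
proof -
  let ?R = "{rTot, rRow, rI, rW, rV, rD, rX, rP}"
  have sel: "halts_in 9
      (Seq (block [Sub rX rThr rTot])
      (Cond rX (block [Add rP rBase rA, Store rP rOne, Sub rK rK rOne]) Skip)) ?Q s'"
    if k: "card S < k" and tot: "reg s' rTot = load n Vs S a" and u: "unchanged ?R s s'" for s'
  proof -
    have r: "represents n Vs S s'" by (rule represents_unchanged[OF s(1) u]) auto
    have rA: "reg s' rA = a" and rK: "reg s' rK = k - card S"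
      using u s by (auto simp: unchanged_def)
    \<comment> \<open>The state after accepting: the comparison and the accepting branch run
      together.\<close>
    define s1 where "s1 = fold step [Sub rX rThr rTot, Add rP rBase rA, Store rP rOne, Sub rK rK rOne] s'"
    have m: "mem s1 = (mem s')(2 + length Vs * n + a := 1)"
      using r rA by (simp add: s1_def represents_def)
    have "stores n (2 + i * n) (Vs ! i) s1" if "i < length Vs" for i
    proof (rule stores_update_other[OF _ _ m])
      show "stores n (2 + i * n) (Vs ! i) s'" using r that by (simp add: represents_def)
      \<comment> \<open>Row \<open>i\<close> ends before the cell of \<open>a\<close> in the vector
        of \<open>S\<close>, so marking \<open>a\<close> leaves the input intact.\<close>
      have "Suc i * n \<le> length Vs * n" using that by (intro mult_le_mono1) simp
      then show "2 + i * n + n < 2 + length Vs * n + a" using s(3) by simp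
    qed
    moreover have "stores n (2 + length Vs * n) (insert a S) s1"
      using r by (intro stores_update[OF _ s(3) m]) (simp add: represents_def)
    ultimately have r1: "represents n Vs (insert a S) s1"
      using r by (simp add: represents_def s1_def)
    have Q1: "?Q s1" if "load n Vs S a < 16 ^ n"
      using r1 k that rA rK S r by (simp add: s1_def represents_def[of _ _ _ s'])
    have r2: "represents n Vs S (s'\<lparr>reg := (reg s')(rX := x)\<rparr>)" for x
      by (rule represents_unchanged[OF r, of "{rX}"]) (auto simp: unchanged_def)
    show ?thesis
    proof (intro halts_in_block_Seq halts_in_Cond halts_in_block halts_in_Skip)
      assume "reg (fold step [Sub rX rThr rTot] s') rX \<noteq> 0"
      then have "load n Vs S a < 16 ^ n" using tot r by (simp add: represents_def)
      from Q1[OF this]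
      show "?Q (fold step [Add rP rBase rA, Store rP rOne, Sub rK rK rOne] (fold step [Sub rX rThr rTot] s'))"
        unfolding s1_def by (simp only: fold.simps comp_apply id_apply)
    next
      assume "reg (fold step [Sub rX rThr rTot] s') rX = 0"
      then have "\<not> load n Vs S a < 16 ^ n" using tot r by (simp add: represents_def)
      then show "?Q (fold step [Sub rX rThr rTot] s')"
        using r2 rA rK by simp
    qed simp_all
  qed
  have run: "halts_in (length Vs * (30 * n + 20) + 20 - 1)
      (Seq load_prog
      (Seq (block [Sub rX rThr rTot])
      (Cond rX (block [Add rP rBase rA, Store rP rOne, Sub rK rK rOne]) Skip))) ?Q s"
    if "card S < k"
    by (rule halts_in_mono[OF halts_in_Seq[OF load_prog[OF s(1-3)] sel]]) (use that in simp_all)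
  show ?thesis
    unfolding pick_prog_def using s
    by (intro halts_in_Cond halts_in_Skip run) simp_all
qed

lemma greedy_prog:
  assumes s: "represents n Vs {} s" "reg s rK = k" "1 \<le> n"
  shows "halts_in (n * (length Vs * (30 * n + 20) + 30) + 10) greedy_prog
    (represents n Vs (greedy n k Vs (n div 2))) s"
proof -
  let ?T = "length Vs * (30 * n + 20)"
  \<comment> \<open>The truncated \<open>n - 1 - 2 * i\<close> first vanishes at
    \<open>i = n div 2\<close>, so the loop makes exactly that many rounds.\<close>
  define I where "I i s' \<longleftrightarrow> represents n Vs (greedy n k Vs i) s' \<and>
    reg s' rK = k - card (greedy n k Vs i) \<and> reg s' rA = 2 * i \<and> reg s' rM = n - 1 - 2 * i" for i s'
  have "reg s' rM \<noteq> 0 \<and> halts_in (?T + 27) greedy_body (I (Suc i)) s'"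
    if i: "i < n div 2" and I: "I i s'" for i s'
  proof
    show "reg s' rM \<noteq> 0" using i I by (simp add: I_def)
  next
    define s1 where "s1 = fold step [Add rA rA rOne, Add rA rA rOne] s'"
    have u: "unchanged {rA} s' s1" by (simp add: s1_def unchanged_def)
    have r: "represents n Vs (greedy n k Vs i) s1"
      by (rule represents_unchanged[OF _ u]) (use I in \<open>auto simp: I_def\<close>)
    have s1: "reg s1 rA = 2 * Suc i" "reg s1 rK = k - card (greedy n k Vs i)"
      using I by (simp_all add: s1_def I_def represents_def)
    have a: "2 * Suc i \<in> {1..n}" using i by auto
    let ?Q = "\<lambda>s'. reg s' rA = 2 * Suc i \<and> represents n Vs (greedy n k Vs (Suc i)) s' \<and>
      reg s' rK = k - card (greedy n k Vs (Suc i))"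
    have p: "halts_in (?T + 20) pick_prog ?Q s1"
      by (rule halts_in_mono[OF pick_prog[OF r s1(1) a s1(2)]])
         (auto simp: finite_greedy next_notin_greedy Let_def)
    have fin: "I (Suc i) (fold step [Sub rM rN rOne, Sub rM rM rA] s')" if "?Q s'" for s'
    proof -
      have "represents n Vs (greedy n k Vs (Suc i)) (fold step [Sub rM rN rOne, Sub rM rM rA] s')"
        by (rule represents_unchanged[of _ _ _ s' "{rM}"]) (use that in \<open>auto simp: unchanged_def\<close>)
      then show ?thesis using that by (simp add: I_def represents_def[of _ _ _ s'] del: greedy.simps)
    qed
    have rest: "halts_in (?T + 23) (Seq pick_prog (block [Sub rM rN rOne, Sub rM rM rA])) (I (Suc i)) s1"
      by (intro halts_in_Seq_block halts_in_mono[OF p] fin) simp_all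
    show "halts_in (?T + 27) greedy_body (I (Suc i)) s'"
      unfolding greedy_body_def
      by (rule halts_in_block_Seq[OF _ halts_in_mono[OF rest[unfolded s1_def]]]) simp_all
  qed
  moreover have "I 0 (fold step [Const rA 0, Sub rM rN rOne] s)"
    using represents_unchanged[OF s(1), of "{rA, rM}" "fold step [Const rA 0, Sub rM rN rOne] s"] s
    by (auto simp: I_def unchanged_def represents_def)
  moreover have "(n div 2) * Suc (?T + 27) \<le> n * (?T + 30)"
    by (intro mult_le_mono) simp_all
  ultimately show ?thesis
    unfolding greedy_prog_def
    by (intro halts_in_block_Seq halts_in_While[where I = I and N = "n div 2" and T = "?T + 27"])
       (auto simp: I_def)
qed

lemma init_prog:
  assumes "mem s 0 = n" "mem s 1 = k" "mem s 2 = l"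
  shows "halts_in (5 * l + 10 * n + 30) init_prog
    (\<lambda>s'. mem s' = mem s \<and> reg s' rN = n \<and> reg s' rK = k \<and> reg s' rL = l \<and>
       reg s' rOne = 1 \<and> reg s' rBase = 2 + l * n \<and> reg s' rThr = 16 ^ n) s"
proof -
  define I where "I i s' \<longleftrightarrow> mem s' = mem s \<and> reg s' rN = n \<and> reg s' rK = k \<and> reg s' rL = l \<and>
    reg s' rOne = 1 \<and> reg s' rBase = 2 + i * n \<and> reg s' rI = l - i" for i and s' :: state
  define J where "J i s' \<longleftrightarrow> mem s' = mem s \<and> reg s' rN = n \<and> reg s' rK = k \<and> reg s' rL = l \<and>
    reg s' rOne = 1 \<and> reg s' rBase = 2 + l * n \<and> reg s' rThr = 16 ^ i \<and> reg s' rI = n - i" for i and s' :: state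
  have base: "reg s' rI \<noteq> 0 \<and> halts_in 4 (block [Add rBase rBase rN, Sub rI rI rOne]) (I (Suc i)) s'"
    if "i < l" "I i s'" for i s'
    using that by (intro conjI halts_in_block) (auto simp: I_def)
  have thr: "reg s' rI \<noteq> 0 \<and>
      halts_in 9 (Seq (block (double 4 rThr)) (block [Sub rI rI rOne])) (J (Suc i)) s'"
    if "i < n" "J i s'" for i s'
    using that by (intro conjI halts_in_block_Seq halts_in_block) (auto simp: J_def)
  let ?loop = "While rI (Seq (block (double 4 rThr)) (block [Sub rI rI rOne]))"
  let ?Q = "\<lambda>s'. mem s' = mem s \<and> reg s' rN = n \<and> reg s' rK = k \<and> reg s' rL = l \<and>
       reg s' rOne = 1 \<and> reg s' rBase = 2 + l * n \<and> reg s' rThr = 16 ^ n"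
  have second: "halts_in (10 * n + 10) (Seq (block [Const rThr 1, Const rI 0, Add rI rN rI]) ?loop) ?Q s'"
    if "I l s'" for s'
    using that
    by (intro halts_in_block_Seq halts_in_While[where I = J and N = n and T = 9, OF _ thr])
       (auto simp: I_def J_def)
  have first: "halts_in (5 * l + 1) (While rI (block [Add rBase rBase rN, Sub rI rI rOne])) (I l) s'"
    if "I 0 s'" for s'
    using that
    by (intro halts_in_While[where I = I and N = l and T = 4, OF _ base]) (auto simp: I_def)
  have rest: "halts_in (5 * l + 10 * n + 11)
    (Seq (While rI (block [Add rBase rBase rN, Sub rI rI rOne]))
    (Seq (block [Const rThr 1, Const rI 0, Add rI rN rI]) ?loop)) ?Q s'" if "I 0 s'" for s'
    by (rule halts_in_mono[OF halts_in_Seq[OF first[OF that] second]]) simp_all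
  show ?thesis
    unfolding init_prog_def using assms
    by (intro halts_in_block_Seq halts_in_mono[OF rest]) (simp_all add: I_def)
qed

text \<open>The destination starts below the source, so copying upwards never overwrites a cell that is
  still to be read, although the two ranges may overlap.\<close>

lemma copy_prog:
  assumes "represents n Vs S s"
  shows "halts_in (10 * n + 10) copy_prog (\<lambda>s'. holds_output s' (char_vector n S)) s"
proof -
  define B where "B = 2 + length Vs * n"
  \<comment> \<open>Vertex \<open>Suc v\<close> goes to cell \<open>v\<close>, since the output
    starts at cell 0. Only the part of the source not yet copied must still be intact.\<close>
  define I where "I i s' \<longleftrightarrow> reg s' rN = n \<and> reg s' rOne = 1 \<and> reg s' rBase = B \<and>
    reg s' rV = i \<and> reg s' rD = n - i \<and>
    (\<forall>v<i. mem s' v = (if Suc v \<in> S then 1 else 0)) \<and>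
    (\<forall>v. i \<le> v \<and> v < n \<longrightarrow> mem s' (B + Suc v) = (if Suc v \<in> S then 1 else 0))" for i and s' :: state
  have "reg s' rD \<noteq> 0 \<and> halts_in 8
      (block [Add rP rBase rV, Add rP rP rOne, Load rX rP, Store rV rX,
              Add rV rV rOne, Sub rD rN rV]) (I (Suc i)) s'" if "i < n" "I i s'" for i s'
    using that by (intro conjI halts_in_block) (auto simp: I_def less_Suc_eq)
  moreover have "mem s (B + Suc v) = (if Suc v \<in> S then 1 else 0)" if "v < n" for v
    using assms that by (intro storesD) (auto simp: represents_def B_def)
  then have "I 0 (fold step [Const rV 0, Sub rD rN rV] s)"
    using assms by (simp add: I_def represents_def B_def)
  moreover have "holds_output s' (char_vector n S)" if "I n s'" for s'
    using that by (auto simp: I_def holds_output_def char_vector_def simp del: upt_Suc)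
  ultimately show ?thesis
    unfolding copy_prog_def
    by (intro halts_in_block_Seq halts_in_While[where I = I and N = n and T = 8])
       (auto simp: I_def)
qed

section \<open>The encoded input and the assembled program\<close>

lemma length_char_vector [simp]: "length (char_vector n S) = n"
  by (simp add: char_vector_def del: upt_Suc)

lemma length_concat_char_vector: "length (concat (map (char_vector n) Vs)) = length Vs * n"
  by (induction Vs) auto

lemma nth_concat_char_vector:
  assumes "i < length Vs" "v < n"
  shows "concat (map (char_vector n) Vs) ! (i * n + v) = (if Suc v \<in> Vs ! i then 1 else 0)"
  using assms
proof (induction Vs arbitrary: i)
  case Nil
  then show ?case by simp
next
  case (Cons V Vs)
  then show ?case
    by (cases i) (auto simp: nth_append char_vector_def simp del: upt_Suc)
qed

text \<open>The input has \<open>3 + l * n\<close> cells and memory behind it is zero, so the empty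
  selection is in place from the start.\<close>

lemma mem_encode_input:
  fixes x :: unfair_input
  defines "s \<equiv> initial_state (encode_input x)"
    and "n \<equiv> num_vertices x" and "l \<equiv> length (subsets x)"
  shows "mem s 0 = n" "mem s 1 = target_size x" "mem s 2 = l"
    and "i < l \<Longrightarrow> stores n (2 + i * n) (subsets x ! i) s"
    and "stores n (2 + l * n) {} s"
proof -
  have len: "length (encode_input x) = 3 + l * n"
    by (simp add: encode_input_def length_concat_char_vector l_def n_def)
  show "mem s 0 = n" "mem s 1 = target_size x" "mem s 2 = l"
    by (simp_all add: s_def initial_state_def encode_input_def n_def l_def)
  show "stores n (2 + l * n) {} s"
    by (simp add: stores_def s_def initial_state_def len)
  show "stores n (2 + i * n) (subsets x ! i) s" if i: "i < l"
    unfolding stores_def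
  proof
    fix v assume v: "v \<in> {1..n}"
    then obtain w where w: "v = Suc w" "w < n" by (cases v) auto
    have "Suc i * n \<le> l * n" using i by (intro mult_le_mono1) simp
    then have "2 + i * n + v < length (encode_input x)" using v len by simp
    then have "mem s (2 + i * n + v) = encode_input x ! (3 + (i * n + w))"
      by (simp add: s_def initial_state_def w eval_nat_numeral)
    also have "\<dots> = (if v \<in> subsets x ! i then 1 else 0)"
      using nth_concat_char_vector[of i "subsets x" w n] i w
      by (simp add: encode_input_def n_def l_def)
    finally show "mem s (2 + i * n + v) = (if v \<in> subsets x ! i then 1 else 0)" .
  qed
qed

text \<open>The bound keeps the shape in which \<open>halts_in_Seq\<close> adds up the three
  phases.\<close>

lemma unfair_prog:
  fixes x :: unfair_input
  defines "n \<equiv> num_vertices x" and "k \<equiv> target_size x" and "Vs \<equiv> subsets x"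
  assumes "1 \<le> n"
  shows "halts_in (5 * length Vs + 10 * n + 30 + (n * (length Vs * (30 * n + 20) + 30) + 10 + (10 * n + 10)))
    unfair_prog (\<lambda>s. holds_output s (char_vector n (greedy n k Vs (n div 2))))
    (initial_state (encode_input x))"
  unfolding unfair_prog_def
proof (rule halts_in_Seq[OF init_prog halts_in_Seq[OF greedy_prog copy_prog]])
  fix s' :: state
  assume s': "mem s' = mem (initial_state (encode_input x)) \<and> reg s' rN = n \<and> reg s' rK = k \<and>
    reg s' rL = length Vs \<and> reg s' rOne = 1 \<and> reg s' rBase = 2 + length Vs * n \<and> reg s' rThr = 16 ^ n"
  then show "represents n Vs {} s'"
    using mem_encode_input(4,5)[where x = x]
    by (auto simp: represents_def stores_def n_def Vs_def)
  show "reg s' rK = k" using s' by simp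
qed (use assms mem_encode_input(1-3)[where x = x] in auto)

theorem theorem1p5:
  "\<exists>c::real. c > 0 \<and>
     poly_time_solvable
       {x \<in> unfair_inputs. real (num_vertices x) \<ge> c * real (target_size x)}
       unfair_solution encode_input encode_solution num_vertices"
proof (intro exI conjI)
  show "poly_time_solvable
    {x \<in> unfair_inputs. real (num_vertices x) \<ge> 1024 * real (target_size x)}
    unfair_solution encode_input encode_solution num_vertices"
    unfolding poly_time_solvable_def
  \<comment> \<open>The polynomial is the bound of \<open>unfair_prog\<close> with the number of
    subsets replaced by \<open>n\<close>.\<close>
  proof (intro exI[of _ unfair_prog] exI[of _ "[:50, 55, 20, 30:]"] ballI)
    fix x assume "x \<in> {x \<in> unfair_inputs. real (num_vertices x) \<ge> 1024 * real (target_size x)}"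
    then have x: "x \<in> unfair_inputs" "1024 * target_size x \<le> num_vertices x" by auto
    define n where "n = num_vertices x"
    define S where "S = greedy n (target_size x) (subsets x) (n div 2)"
    let ?l = "length (subsets x)"
    \<comment> \<open>The second bound uses \<open>target_size x \<ge> 1\<close>, which makes n - 2k
      + 1 at most n.\<close>
    have n: "1 \<le> n" "?l \<le> n" using x by (auto simp: unfair_inputs_def n_def)
    obtain t s where run: "exec unfair_prog (initial_state (encode_input x)) t s"
        "holds_output s (char_vector n S)"
      and t: "t \<le> 5 * ?l + 10 * n + 30 + (n * (?l * (30 * n + 20) + 30) + 10 + (10 * n + 10))"
      using unfair_prog[of x] n(1) by (auto simp: halts_in_def n_def S_def)
    have "n * (?l * (30 * n + 20) + 30) \<le> n * (n * (30 * n + 20) + 30)"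
      using n(2) by (intro mult_le_mono add_mono le_refl)
    then have "t \<le> 50 + 25 * n + n * (n * (30 * n + 20) + 30)" using t n(2) by linarith
    also have "\<dots> = poly [:50, 55, 20, 30:] n" by (simp add: algebra_simps)
    finally have "exec unfair_prog (initial_state (encode_input x)) t s \<and>
        t \<le> poly [:50, 55, 20, 30:] (num_vertices x) \<and>
        unfair_solution x S \<and> holds_output s (encode_solution x S)"
      using run greedy_solution[OF x] by (simp add: n_def S_def encode_solution_def)
    then show "\<exists>t s y. exec unfair_prog (initial_state (encode_input x)) t s \<and>
        t \<le> poly [:50, 55, 20, 30:] (num_vertices x) \<and>
        unfair_solution x y \<and> holds_output s (encode_solution x y)"
      by blast
  qed
qed simp

end
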